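(* Let $(X,\mu)$ and $(Y,\nu)$ be strong generalized topological spaces and let $f:(X,\mu)\to(Y,\nu)$ be a surjective mapping. Then the following conditions are equivalent. (1) $f$ is a $g$-pseudo-open mapping. (2) $f$ is a hereditarily $g$-quotient mapping. (3) For every $B\subseteq Y$, $C(B)\subseteq f(C(f^{-1}(B)))$.
   Context: A generalized topological space is a pair $(X,\mu)$ where $X$ is a set and $\mu$ is a family of subsets of $X$ such that $\emptyset\in\mu$ and any union of elements of $\mu$ belongs to $\mu$ (intersections are not required to belong to $\mu$). It is strong if $X\in\mu$. A set $B\subseteq X$ is $\mu$-open if $B\in\mu$, and $\mu$-closed if $X\setminus B\in\mu$. The interior $I(B)$ is the union of all $\mu$-open subsets of $B$, and the closure $C(B)$ is the intersection of all $\mu$-closed sets containing $B$; interiors and closures are taken in the space of which the set is a subset ($(X,\mu)$ or $(Y,\nu)$). No continuity of $f$ is assumed. The mapping $f$ is $g$-pseudo-open if for each $y\in Y$ and each $U\in\mu$ with $f^{-1}(y)\subseteq U$, one has $y\in I(f(U))$, where $f^{-1}(y)$ denotes the fibre $f^{-1}(\{y\})$. The mapping $f$ is $g$-quotient if for each $V\subseteq Y$, $f^{-1}(V)\in\mu$ implies $V\in\nu$. The mapping $f$ is hereditarily $g$-quotient if for each $Y'\subseteq Y$ the restriction $f|_{f^{-1}(Y')}:(f^{-1}(Y'),\mu')\to(Y',\nu')$ is $g$-quotient, where $\mu'=\{U\cap f^{-1}(Y'):U\in\mu\}$ and $\nu'=\{V\cap Y':V\in\nu\}$. *)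

theory Defs
  imports "HOL-Library.FuncSet"
begin

text \<open>
  A generalized topological space is given by an explicit carrier \<open>X\<close> and a family \<open>\<mu>\<close> of
  subsets of \<open>X\<close>. A mapping \<open>f\<close> from \<open>X\<close> to \<open>Y\<close> is an element of \<open>X \<rightarrow> Y\<close>; the values of \<open>f\<close>
  outside \<open>X\<close> are irrelevant, so preimages are always cut down to the carrier.
\<close>

definition gen_topology :: "'a set \<Rightarrow> 'a set set \<Rightarrow> bool" where
  "gen_topology X \<mu> \<longleftrightarrow> \<mu> \<subseteq> Pow X \<and> {} \<in> \<mu> \<and> (\<forall>\<U>. \<U> \<subseteq> \<mu> \<longrightarrow> \<Union>\<U> \<in> \<mu>)"

definition strong_gen_topology :: "'a set \<Rightarrow> 'a set set \<Rightarrow> bool" where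
  "strong_gen_topology X \<mu> \<longleftrightarrow> gen_topology X \<mu> \<and> X \<in> \<mu>"

definition g_closed :: "'a set \<Rightarrow> 'a set set \<Rightarrow> 'a set \<Rightarrow> bool" where
  "g_closed X \<mu> B \<longleftrightarrow> B \<subseteq> X \<and> X - B \<in> \<mu>"

definition g_interior :: "'a set set \<Rightarrow> 'a set \<Rightarrow> 'a set" where
  "g_interior \<mu> B = \<Union>{U. U \<in> \<mu> \<and> U \<subseteq> B}"

text \<open>
  The family intersected here is nonempty for \<open>B \<subseteq> X\<close>, since \<open>X\<close> itself is closed
  (the empty set is open).
\<close>

definition g_closure :: "'a set \<Rightarrow> 'a set set \<Rightarrow> 'a set \<Rightarrow> 'a set" where
  "g_closure X \<mu> B = \<Inter>{F. g_closed X \<mu> F \<and> B \<subseteq> F}"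

definition preimg :: "('a \<Rightarrow> 'b) \<Rightarrow> 'a set \<Rightarrow> 'b set \<Rightarrow> 'a set" where
  "preimg f X B = f -` B \<inter> X"

definition g_pseudo_open ::
  "'a set \<Rightarrow> 'a set set \<Rightarrow> 'b set \<Rightarrow> 'b set set \<Rightarrow> ('a \<Rightarrow> 'b) \<Rightarrow> bool" where
  "g_pseudo_open X \<mu> Y \<nu> f \<longleftrightarrow>
     (\<forall>y\<in>Y. \<forall>U\<in>\<mu>. preimg f X {y} \<subseteq> U \<longrightarrow> y \<in> g_interior \<nu> (f ` U))"

definition g_quotient ::
  "'a set \<Rightarrow> 'a set set \<Rightarrow> 'b set \<Rightarrow> 'b set set \<Rightarrow> ('a \<Rightarrow> 'b) \<Rightarrow> bool" where
  "g_quotient X \<mu> Y \<nu> f \<longleftrightarrow> (\<forall>V. V \<subseteq> Y \<longrightarrow> preimg f X V \<in> \<mu> \<longrightarrow> V \<in> \<nu>)"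

definition g_subspace :: "'a set set \<Rightarrow> 'a set \<Rightarrow> 'a set set" where
  "g_subspace \<mu> A = {U \<inter> A | U. U \<in> \<mu>}"

definition hereditarily_g_quotient ::
  "'a set \<Rightarrow> 'a set set \<Rightarrow> 'b set \<Rightarrow> 'b set set \<Rightarrow> ('a \<Rightarrow> 'b) \<Rightarrow> bool" where
  "hereditarily_g_quotient X \<mu> Y \<nu> f \<longleftrightarrow>
     (\<forall>Y'. Y' \<subseteq> Y \<longrightarrow>
        g_quotient (preimg f X Y') (g_subspace \<mu> (preimg f X Y')) Y' (g_subspace \<nu> Y')
          (restrict f (preimg f X Y')))"

end

theory Submission
  imports Defs
begin

text \<open>
  All three conditions say that an open set \<open>U\<close> containing the fibre of \<open>y\<close> yields an open
  neighbourhood of \<open>y\<close> inside \<open>f ` U\<close>; they differ only in how \<open>f ` U\<close> enters. A pseudo-open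
  map satisfies this directly. The closure condition is its complement: the set \<open>B\<close> to look at is
  \<open>Y - f ` U\<close>, whose preimage misses \<open>U\<close>, and in the other direction \<open>U\<close> is the complement of the
  closure of the preimage of \<open>B\<close>. The hereditary condition sees it through the subset
  \<open>Y' = insert y (Y - f ` U)\<close>: inside the preimage of \<open>Y'\<close> the set \<open>U\<close> cuts out exactly the fibre
  of \<open>y\<close>, so the quotient property makes \<open>{y}\<close> relatively open in \<open>Y'\<close>, and an open set meeting
  \<open>Y'\<close> in \<open>{y}\<close> only is a neighbourhood of \<open>y\<close> inside \<open>f ` U\<close>.

  Open sets are combined only in passing from a neighbourhood of each point to an open set, and
  this takes a union. That is why the equivalence holds for generalized topologies.
\<close>

lemma in_g_interior_iff: "y \<in> g_interior \<nu> A \<longleftrightarrow> (\<exists>V\<in>\<nu>. y \<in> V \<and> V \<subseteq> A)"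
  unfolding g_interior_def by blast

lemma g_interior_open:
  assumes "gen_topology Y \<nu>"
  shows "g_interior \<nu> A \<in> \<nu>"
proof -
  have "{V. V \<in> \<nu> \<and> V \<subseteq> A} \<subseteq> \<nu>" by blast
  with assms show ?thesis
    unfolding gen_topology_def g_interior_def by blast
qed

lemma g_closure_subset_closed:
  assumes "g_closed X \<mu> F" and "B \<subseteq> F"
  shows "g_closure X \<mu> B \<subseteq> F"
  using assms unfolding g_closure_def by blast

lemma not_in_g_closure_iff:
  assumes "gen_topology Y \<nu>" and "B \<subseteq> Y" and "y \<in> Y"
  shows "y \<notin> g_closure Y \<nu> B \<longleftrightarrow> (\<exists>V\<in>\<nu>. y \<in> V \<and> V \<inter> B = {})"
proof
  assume "y \<notin> g_closure Y \<nu> B"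
  then obtain F where "g_closed Y \<nu> F" "B \<subseteq> F" "y \<notin> F"
    unfolding g_closure_def by blast
  then show "\<exists>V\<in>\<nu>. y \<in> V \<and> V \<inter> B = {}"
    using assms(3) unfolding g_closed_def by blast
next
  assume "\<exists>V\<in>\<nu>. y \<in> V \<and> V \<inter> B = {}"
  then obtain V where V: "V \<in> \<nu>" "y \<in> V" "V \<inter> B = {}" by blast
  with assms(1) have "V \<subseteq> Y" unfolding gen_topology_def by blast
  then have "Y - (Y - V) = V" by blast
  with V have "g_closed Y \<nu> (Y - V)" unfolding g_closed_def by simp
  moreover have "B \<subseteq> Y - V" using V assms(2) by blast
  ultimately have "g_closure Y \<nu> B \<subseteq> Y - V"
    by (rule g_closure_subset_closed)
  with V show "y \<notin> g_closure Y \<nu> B" by blast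
qed

lemma g_closure_compl_open:
  assumes "gen_topology X \<mu>" and "B \<subseteq> X"
  shows "X - g_closure X \<mu> B \<in> \<mu>"
proof -
  \<comment> \<open>The points outside the closure are those having a neighbourhood that misses \<open>B\<close>.\<close>
  have "X - g_closure X \<mu> B = g_interior \<mu> (X - B)"
  proof (rule set_eqI)
    fix x
    have sub: "V \<subseteq> X" if "V \<in> \<mu>" for V
      using that assms(1) unfolding gen_topology_def by blast
    show "x \<in> X - g_closure X \<mu> B \<longleftrightarrow> x \<in> g_interior \<mu> (X - B)"
    proof (cases "x \<in> X")
      case True
      have "V \<inter> B = {} \<longleftrightarrow> V \<subseteq> X - B" if "V \<in> \<mu>" for V
        using sub[OF that] by blast
      then show ?thesis
        using True not_in_g_closure_iff[OF assms True] by (auto simp: in_g_interior_iff)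
    next
      case False
      then show ?thesis by (auto simp: in_g_interior_iff)
    qed
  qed
  with g_interior_open[OF assms(1)] show ?thesis by simp
qed

lemma preimg_restrict:
  assumes "V \<subseteq> Y'"
  shows "preimg (restrict f (preimg f X Y')) (preimg f X Y') V = preimg f X V"
  using assms unfolding preimg_def by auto

lemma hereditarily_g_quotient_iff:
  "hereditarily_g_quotient X \<mu> Y \<nu> f \<longleftrightarrow>
     (\<forall>Y' V. Y' \<subseteq> Y \<longrightarrow> V \<subseteq> Y' \<longrightarrow>
        (\<exists>U\<in>\<mu>. preimg f X V = U \<inter> preimg f X Y') \<longrightarrow> (\<exists>W\<in>\<nu>. V = W \<inter> Y'))"
proof -
  have sub: "A \<in> g_subspace \<tau> S \<longleftrightarrow> (\<exists>U\<in>\<tau>. A = U \<inter> S)" for A S :: "'c set" and \<tau>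
    unfolding g_subspace_def by blast
  show ?thesis
    unfolding hereditarily_g_quotient_def g_quotient_def sub
    by (simp add: preimg_restrict cong: imp_cong)
qed

text \<open>
  If the preimage of \<open>V\<close> is the trace of \<open>U\<close> on the preimage of \<open>Y'\<close>, then \<open>f ` U\<close> traces \<open>V\<close> on
  \<open>Y'\<close>. The image \<open>f ` U\<close> need not be open, but pseudo-openness puts every point of \<open>V\<close> in its
  interior, so the interior is an open set with the same trace.
\<close>

lemma pseudo_open_imp_hereditarily_quotient:
  assumes top: "gen_topology X \<mu>" "gen_topology Y \<nu>"
    and po: "g_pseudo_open X \<mu> Y \<nu> f"
  shows "hereditarily_g_quotient X \<mu> Y \<nu> f"
  unfolding hereditarily_g_quotient_iff
proof (intro allI impI)
  fix Y' V
  assume Y': "Y' \<subseteq> Y" and V: "V \<subseteq> Y'"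
    and "\<exists>U\<in>\<mu>. preimg f X V = U \<inter> preimg f X Y'"
  then obtain U where U: "U \<in> \<mu>" and eq: "preimg f X V = U \<inter> preimg f X Y'" by blast
  have UX: "U \<subseteq> X" using U top(1) unfolding gen_topology_def by blast
  have "V \<subseteq> g_interior \<nu> (f ` U)"
  proof
    fix y assume y: "y \<in> V"
    then have "preimg f X {y} \<subseteq> preimg f X V" unfolding preimg_def by blast
    with eq have "preimg f X {y} \<subseteq> U" by blast
    moreover have "y \<in> Y" using y V Y' by blast
    ultimately show "y \<in> g_interior \<nu> (f ` U)"
      using po U unfolding g_pseudo_open_def by blast
  qed
  moreover have "g_interior \<nu> (f ` U) \<inter> Y' \<subseteq> V"
  proof
    fix y assume y: "y \<in> g_interior \<nu> (f ` U) \<inter> Y'"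
    then have "y \<in> f ` U" unfolding Int_iff in_g_interior_iff by blast
    then obtain x where "x \<in> U" "y = f x" by blast
    with y UX have "x \<in> U \<inter> preimg f X Y'" unfolding preimg_def by blast
    with eq \<open>y = f x\<close> show "y \<in> V" unfolding preimg_def by blast
  qed
  ultimately have "V = g_interior \<nu> (f ` U) \<inter> Y'" using V by blast
  with g_interior_open[OF top(2)] show "\<exists>W\<in>\<nu>. V = W \<inter> Y'" by blast
qed

lemma hereditarily_quotient_imp_pseudo_open:
  assumes top: "gen_topology X \<mu>" "gen_topology Y \<nu>"
    and surj: "f ` X = Y"
    and hq: "hereditarily_g_quotient X \<mu> Y \<nu> f"
  shows "g_pseudo_open X \<mu> Y \<nu> f"
  unfolding g_pseudo_open_def
proof (intro ballI impI)
  fix y U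
  assume y: "y \<in> Y" and U: "U \<in> \<mu>" and fib: "preimg f X {y} \<subseteq> U"
  \<comment> \<open>Keep \<open>y\<close> and remove every other value taken on \<open>U\<close>, so that \<open>U\<close> leaves only the fibre.\<close>
  define Y' where "Y' = insert y (Y - f ` U)"
  have "U \<subseteq> X" using U top(1) unfolding gen_topology_def by blast
  with fib have "preimg f X {y} = U \<inter> preimg f X Y'"
    unfolding preimg_def Y'_def by auto
  moreover have "Y' \<subseteq> Y" "{y} \<subseteq> Y'" using y unfolding Y'_def by auto
  ultimately obtain W where W: "W \<in> \<nu>" "{y} = W \<inter> Y'"
    using hq U unfolding hereditarily_g_quotient_iff by meson
  \<comment> \<open>Surjectivity makes the fibre nonempty.\<close>
  have "y \<in> f ` U" using y surj fib unfolding preimg_def by blast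
  moreover have "W \<subseteq> Y" using W top(2) unfolding gen_topology_def by blast
  ultimately have "W \<subseteq> f ` U" using W(2) unfolding Y'_def by blast
  with W show "y \<in> g_interior \<nu> (f ` U)" unfolding in_g_interior_iff by blast
qed

lemma pseudo_open_imp_closure_subset:
  assumes top: "gen_topology X \<mu>" "gen_topology Y \<nu>"
    and po: "g_pseudo_open X \<mu> Y \<nu> f" and B: "B \<subseteq> Y"
  shows "g_closure Y \<nu> B \<subseteq> f ` g_closure X \<mu> (preimg f X B)"
proof (rule subsetI, rule ccontr)
  fix y
  assume y: "y \<in> g_closure Y \<nu> B" and out: "y \<notin> f ` g_closure X \<mu> (preimg f X B)"
  have "g_closed Y \<nu> Y" using top(2) unfolding g_closed_def gen_topology_def by simp
  with y B have yY: "y \<in> Y" using g_closure_subset_closed by blast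
  define U where "U = X - g_closure X \<mu> (preimg f X B)"
  have "preimg f X B \<subseteq> X" unfolding preimg_def by blast
  then have "U \<in> \<mu>" unfolding U_def by (rule g_closure_compl_open[OF top(1)])
  moreover have "preimg f X {y} \<subseteq> U" using out unfolding U_def preimg_def by blast
  ultimately obtain V where V: "V \<in> \<nu>" "y \<in> V" "V \<subseteq> f ` U"
    using po yY unfolding g_pseudo_open_def in_g_interior_iff by blast
  have "preimg f X B \<subseteq> g_closure X \<mu> (preimg f X B)"
    unfolding g_closure_def by blast
  then have "f ` U \<inter> B = {}" unfolding U_def preimg_def by blast
  with V have "\<exists>V\<in>\<nu>. y \<in> V \<and> V \<inter> B = {}" by blast
  with y show False using not_in_g_closure_iff[OF top(2) B yY] by blast
qed

lemma closure_subset_imp_pseudo_open: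
  assumes top: "gen_topology X \<mu>" "gen_topology Y \<nu>"
    and cl: "\<And>B. B \<subseteq> Y \<Longrightarrow> g_closure Y \<nu> B \<subseteq> f ` g_closure X \<mu> (preimg f X B)"
  shows "g_pseudo_open X \<mu> Y \<nu> f"
  unfolding g_pseudo_open_def
proof (intro ballI impI)
  fix y U
  assume y: "y \<in> Y" and U: "U \<in> \<mu>" and fib: "preimg f X {y} \<subseteq> U"
  let ?B = "Y - f ` U"
  have "U \<subseteq> X" using U top(1) unfolding gen_topology_def by blast
  then have "X - (X - U) = U" by blast
  with U have "g_closed X \<mu> (X - U)" unfolding g_closed_def by simp
  moreover have "preimg f X ?B \<subseteq> X - U" unfolding preimg_def by blast
  ultimately have "g_closure X \<mu> (preimg f X ?B) \<subseteq> X - U"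
    by (rule g_closure_subset_closed)
  with fib have "y \<notin> f ` g_closure X \<mu> (preimg f X ?B)" unfolding preimg_def by blast
  with cl[of ?B] have "y \<notin> g_closure Y \<nu> ?B" by blast
  with not_in_g_closure_iff[OF top(2) _ y, of ?B]
  obtain V where V: "V \<in> \<nu>" "y \<in> V" "V \<inter> ?B = {}" by blast
  moreover have "V \<subseteq> Y" using V top(2) unfolding gen_topology_def by blast
  ultimately show "y \<in> g_interior \<nu> (f ` U)" unfolding in_g_interior_iff by blast
qed

theorem theorem4:
  fixes X :: "'a set" and \<mu> :: "'a set set"
    and Y :: "'b set" and \<nu> :: "'b set set"
    and f :: "'a \<Rightarrow> 'b"
  assumes "strong_gen_topology X \<mu>"
    and "strong_gen_topology Y \<nu>"
    and "f \<in> X \<rightarrow> Y"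
    and "f ` X = Y"
  shows "(g_pseudo_open X \<mu> Y \<nu> f \<longleftrightarrow> hereditarily_g_quotient X \<mu> Y \<nu> f)
    \<and> (hereditarily_g_quotient X \<mu> Y \<nu> f \<longleftrightarrow>
         (\<forall>B. B \<subseteq> Y \<longrightarrow> g_closure Y \<nu> B \<subseteq> f ` g_closure X \<mu> (preimg f X B)))"
proof -
  have top: "gen_topology X \<mu>" "gen_topology Y \<nu>"
    using assms(1,2) unfolding strong_gen_topology_def by auto
  have "g_pseudo_open X \<mu> Y \<nu> f \<longleftrightarrow> hereditarily_g_quotient X \<mu> Y \<nu> f"
    using pseudo_open_imp_hereditarily_quotient[OF top]
      hereditarily_quotient_imp_pseudo_open[OF top assms(4)] by blast
  moreover have "g_pseudo_open X \<mu> Y \<nu> f \<longleftrightarrow>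
      (\<forall>B. B \<subseteq> Y \<longrightarrow> g_closure Y \<nu> B \<subseteq> f ` g_closure X \<mu> (preimg f X B))"
    using pseudo_open_imp_closure_subset[OF top] closure_subset_imp_pseudo_open[OF top] by blast
  ultimately show ?thesis by blast
qed

end
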